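(* Let $\mathcal{C}$ be a finite abstract simplicial complex and $\mathcal{M}$ a matroid on the same finite ground set $V$, and let $1\le k\le r(\mathcal{M})$ and $m\ge0$ be integers. If $\eta_H(\mathcal{C}[X])+r(\mathcal{M}[V\setminus X])\ge k+m$ for all $X\subseteq V$ for which $V\setminus X$ is a flat of $\mathcal{M}$ of rank at most $k-1$, then $\eta_H(\mathbf{Int}(\mathcal{C},\mathcal{M};k))\ge m+1$.
   Context: $\mathcal{C}[X]=\{\sigma\in\mathcal{C}:\sigma\subseteq X\}$, $\mathcal{M}[X]=\{A\in\mathcal{M}:A\subseteq X\}$, $r$ is matroid rank; a flat of $\mathcal{M}$ is $F\subseteq V$ with $r(\mathcal{M}[F\cup\{x\}])>r(\mathcal{M}[F])$ for all $x\in V\setminus F$. $\eta_H(\mathcal{K})$ is $2$ plus the largest $k\ge-2$ with $\widetilde H_j(\mathcal{K};\mathbb{Q})=0$ for all $-1\le j\le k$ ($\widetilde H_{-1}=0$ meaning $\mathcal{K}$ has a vertex), possibly $\infty$. For a matroid $\mathcal{N}$ on $V$, $\mathbf{Int}(\mathcal{C},\mathcal{N})$ is the simplicial complex whose vertices are the simplices of $\mathcal{C}$ containing a basis of $\mathcal{N}$, and whose simplices are the chains $\sigma_1\subset\cdots\subset\sigma_\ell$ of such simplices. $\mathbf{Int}(\mathcal{C},\mathcal{M};k)=\mathbf{Int}(\mathcal{C},\mathcal{M}_{\le k})$, where $\mathcal{M}_{\le k}=\{A\in\mathcal{M}:|A|\le k\}$. *)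

theory Defs
  imports Main "HOL-Library.Extended_Nat"
begin

definition simplicial_complex :: "'v set \<Rightarrow> 'v set set \<Rightarrow> bool" where
  "simplicial_complex V C \<longleftrightarrow> finite V \<and> C \<subseteq> Pow V \<and> (\<forall>\<sigma>\<in>C. \<forall>\<tau>. \<tau> \<subseteq> \<sigma> \<longrightarrow> \<tau> \<in> C)"

definition induced :: "'v set set \<Rightarrow> 'v set \<Rightarrow> 'v set set" where
  "induced C X = {\<sigma> \<in> C. \<sigma> \<subseteq> X}"

text \<open>A fixed (arbitrary) linear order on the vertex type, used to orient simplices.
  Homology does not depend on this choice.\<close>
definition vorder :: "'a rel" where
  "vorder = (SOME r. well_order_on UNIV r)"

text \<open>Faces of dimension j of the augmented complex: the empty face is the unique
  (-1)-dimensional face (augmentation, giving reduced homology).\<close>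
definition faces :: "'a set set \<Rightarrow> int \<Rightarrow> 'a set set" where
  "faces K j = {\<sigma>. (\<sigma> \<in> K \<or> \<sigma> = {}) \<and> finite \<sigma> \<and> int (card \<sigma>) = j + 1}"

definition face_sign :: "'a \<Rightarrow> 'a set \<Rightarrow> rat" where
  "face_sign v \<sigma> = (-1) ^ card {u \<in> \<sigma>. (u, v) \<in> vorder \<and> u \<noteq> v}"

definition bdry :: "'a set set \<Rightarrow> int \<Rightarrow> ('a set \<Rightarrow> rat) \<Rightarrow> 'a set \<Rightarrow> rat" where
  "bdry K j c \<tau> = (if \<tau> \<in> faces K (j - 1)
      then (\<Sum>\<sigma>\<in>{\<sigma> \<in> faces K j. \<tau> \<subseteq> \<sigma>}. face_sign (the_elem (\<sigma> - \<tau>)) \<sigma> * c \<sigma>)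
      else 0)"

definition is_chain :: "'a set set \<Rightarrow> int \<Rightarrow> ('a set \<Rightarrow> rat) \<Rightarrow> bool" where
  "is_chain K j c \<longleftrightarrow> (\<forall>\<sigma>. c \<sigma> \<noteq> 0 \<longrightarrow> \<sigma> \<in> faces K j)"

definition red_hom_vanishes :: "'a set set \<Rightarrow> int \<Rightarrow> bool" where
  "red_hom_vanishes K j \<longleftrightarrow>
     (\<forall>c. is_chain K j c \<and> (\<forall>\<tau>. bdry K j c \<tau> = 0) \<longrightarrow>
        (\<exists>d. is_chain K (j + 1) d \<and> (\<forall>\<tau>. bdry K (j + 1) d \<tau> = c \<tau>)))"

definition eta_H :: "'a set set \<Rightarrow> enat" where
  "eta_H K = Sup {enat n | n. \<forall>j::int. -1 \<le> j \<and> j \<le> int n - 2 \<longrightarrow> red_hom_vanishes K j}"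

definition matroid :: "'v set \<Rightarrow> 'v set set \<Rightarrow> bool" where
  "matroid V M \<longleftrightarrow> finite V \<and> M \<subseteq> Pow V \<and> {} \<in> M \<and>
     (\<forall>A\<in>M. \<forall>B. B \<subseteq> A \<longrightarrow> B \<in> M) \<and>
     (\<forall>A\<in>M. \<forall>B\<in>M. card A < card B \<longrightarrow> (\<exists>x\<in>B - A. insert x A \<in> M))"

definition mrank :: "'v set set \<Rightarrow> nat" where
  "mrank M = Max (card ` M)"

definition flat :: "'v set \<Rightarrow> 'v set set \<Rightarrow> 'v set \<Rightarrow> bool" where
  "flat V M F \<longleftrightarrow> F \<subseteq> V \<and>
     (\<forall>x \<in> V - F. mrank (induced M (F \<union> {x})) > mrank (induced M F))"

definition is_basis :: "'v set set \<Rightarrow> 'v set \<Rightarrow> bool" where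
  "is_basis N B \<longleftrightarrow> B \<in> N \<and> (\<forall>A\<in>N. B \<subseteq> A \<longrightarrow> A = B)"

definition truncation :: "'v set set \<Rightarrow> nat \<Rightarrow> 'v set set" where
  "truncation M k = {A \<in> M. card A \<le> k}"

definition Int_cx :: "'v set set \<Rightarrow> 'v set set \<Rightarrow> 'v set set set" where
  "Int_cx C N = {S. S \<subseteq> {\<sigma> \<in> C. \<exists>B. is_basis N B \<and> B \<subseteq> \<sigma>} \<and>
                    (\<forall>a\<in>S. \<forall>b\<in>S. a \<subseteq> b \<or> b \<subseteq> a)}"

end

theory Submission
  imports Defs
begin

text \<open>For a flat \<open>F\<close> let \<open>P F\<close> be the set of simplices of \<open>C\<close> not contained in \<open>F\<close>, an up-set of the
  face poset. Its order complex is, up to homotopy, \<open>C\<close> minus the subcomplex \<open>C[F]\<close>, hence equivalent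
  to \<open>C[V - F]\<close>. Since \<open>P F \<union> P G = P (F \<inter> G)\<close>, and order complexes of up-sets turn unions into
  unions, Mayer-Vietoris bounds the connectivity of an intersection of sets \<open>P F\<close> with \<open>r(F) \<le> j\<close> in
  terms of intersections of sets \<open>P (F \<inter> G)\<close> with \<open>r(F \<inter> G) < j\<close>. The dimension lost in each
  Mayer-Vietoris step is thus paid for by the drop in rank. The simplices of rank at least \<open>k\<close> form
  the intersection of \<open>P F\<close> over all flats of rank at most \<open>k - 1\<close>.\<close>

section \<open>Simplicial chains without explicit grading\<close>

text \<open>The simplicial signs only need an antisymmetric comparison of vertices, not a transitive one.\<close>
definition tournament :: "('a \<Rightarrow> 'a \<Rightarrow> bool) \<Rightarrow> bool" where
  "tournament lt \<longleftrightarrow> (\<forall>u. \<not> lt u u) \<and> (\<forall>u v. u \<noteq> v \<longrightarrow> (lt u v \<longleftrightarrow> \<not> lt v u))"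

definition incidence :: "('a \<Rightarrow> 'a \<Rightarrow> bool) \<Rightarrow> 'a \<Rightarrow> 'a set \<Rightarrow> rat" where
  "incidence lt v \<sigma> = (-1) ^ card {u \<in> \<sigma>. lt u v}"

text \<open>Summing over the missing vertices \<open>v\<close> makes the operator independent of the
  dimension and of the complex; both enter only through the support of \<open>c\<close>.\<close>

definition boundary :: "('a \<Rightarrow> 'a \<Rightarrow> bool) \<Rightarrow> 'a set \<Rightarrow> ('a set \<Rightarrow> rat) \<Rightarrow> 'a set \<Rightarrow> rat" where
  "boundary lt U c \<tau> = (\<Sum>v\<in>U - \<tau>. incidence lt v (insert v \<tau>) * c (insert v \<tau>))"

definition supported :: "'a set set \<Rightarrow> nat \<Rightarrow> ('a set \<Rightarrow> rat) \<Rightarrow> bool" where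
  "supported K p c \<longleftrightarrow> (\<forall>\<sigma>. c \<sigma> \<noteq> 0 \<longrightarrow> \<sigma> \<in> K \<and> card \<sigma> = p)"

text \<open>The index \<open>p\<close> counts vertices: this is vanishing of reduced homology in dimension \<open>p - 1\<close>.\<close>
definition acyclic_at :: "('a \<Rightarrow> 'a \<Rightarrow> bool) \<Rightarrow> 'a set \<Rightarrow> 'a set set \<Rightarrow> nat \<Rightarrow> bool" where
  "acyclic_at lt U K p \<longleftrightarrow> (\<forall>c. supported K p c \<and> boundary lt U c = (\<lambda>_. 0) \<longrightarrow>
     (\<exists>d. supported K (Suc p) d \<and> boundary lt U d = c))"

section \<open>Signs and the square of the boundary operator\<close>

lemma simplicial_complex_downward: "simplicial_complex U K \<Longrightarrow> \<sigma> \<in> K \<Longrightarrow> \<tau> \<subseteq> \<sigma> \<Longrightarrow> \<tau> \<in> K"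
  by (simp add: simplicial_complex_def)

lemma incidence_insert:
  assumes "tournament lt" "finite \<tau>" "u \<notin> \<tau>" "u \<noteq> v"
  shows "incidence lt v (insert u \<tau>) = (if lt u v then - incidence lt v \<tau> else incidence lt v \<tau>)"
proof (cases "lt u v")
  case True
  then have "{w \<in> insert u \<tau>. lt w v} = insert u {w \<in> \<tau>. lt w v}" by auto
  then show ?thesis using assms True by (simp add: incidence_def)
next
  case False
  then have "{w \<in> insert u \<tau>. lt w v} = {w \<in> \<tau>. lt w v}" by auto
  then show ?thesis using False by (simp add: incidence_def)
qed

lemma incidence_square [simp]: "incidence lt v \<sigma> * incidence lt v \<sigma> = 1"
  by (simp add: incidence_def flip: power_add)

lemma incidence_nonzero [simp]: "incidence lt v \<sigma> \<noteq> 0"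
  by (simp add: incidence_def)

text \<open>Exactly one of \<open>u\<close> and \<open>v\<close> precedes the other. Inserting it
  flips the sign of the later one, while inserting the later one leaves the sign of the earlier one
  alone, so the two products differ by one sign.\<close>

lemma incidence_anticommute:
  assumes "tournament lt" "finite \<tau>" "u \<notin> \<tau>" "v \<notin> \<tau>" "u \<noteq> v"
  shows "incidence lt u (insert u \<tau>) * incidence lt v (insert v (insert u \<tau>))
       = - (incidence lt v (insert v \<tau>) * incidence lt u (insert u (insert v \<tau>)))"
proof -
  have "incidence lt v (insert v (insert u \<tau>)) =
      (if lt u v then - incidence lt v (insert v \<tau>) else incidence lt v (insert v \<tau>))"
    using incidence_insert[of lt "insert v \<tau>" u v] assms by (simp add: insert_commute)
  moreover have "incidence lt u (insert u (insert v \<tau>)) =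
      (if lt v u then - incidence lt u (insert u \<tau>) else incidence lt u (insert u \<tau>))"
    using incidence_insert[of lt "insert u \<tau>" v u] assms by (simp add: insert_commute)
  moreover have "lt u v \<longleftrightarrow> \<not> lt v u"
    using assms unfolding tournament_def by blast
  ultimately show ?thesis by (cases "lt u v") simp_all
qed

lemma boundary_add: "boundary lt U (\<lambda>\<sigma>. c \<sigma> + d \<sigma>) = (\<lambda>\<tau>. boundary lt U c \<tau> + boundary lt U d \<tau>)"
  by (simp add: boundary_def fun_eq_iff sum.distrib distrib_left)

lemma boundary_diff: "boundary lt U (\<lambda>\<sigma>. c \<sigma> - d \<sigma>) = (\<lambda>\<tau>. boundary lt U c \<tau> - boundary lt U d \<tau>)"
  by (simp add: boundary_def fun_eq_iff sum_subtractf right_diff_distrib)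

lemma supported_add: "supported K p c \<Longrightarrow> supported K p d \<Longrightarrow> supported K p (\<lambda>\<sigma>. c \<sigma> + d \<sigma>)"
  unfolding supported_def by (metis add.right_neutral)

lemma supported_diff: "supported K p c \<Longrightarrow> supported K p d \<Longrightarrow> supported K p (\<lambda>\<sigma>. c \<sigma> - d \<sigma>)"
  unfolding supported_def by (metis diff_zero)

lemma supported_mono: "supported K p c \<Longrightarrow> K \<subseteq> L \<Longrightarrow> supported L p c"
  by (auto simp: supported_def)

lemma supported_boundary:
  assumes K: "simplicial_complex U K" and c: "supported K (Suc p) c"
  shows "supported K p (boundary lt U c)"
  unfolding supported_def
proof (intro allI impI)
  fix \<tau> assume "boundary lt U c \<tau> \<noteq> 0"
  then obtain v where v: "v \<in> U - \<tau>" "c (insert v \<tau>) \<noteq> 0"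
    unfolding boundary_def by (metis (no_types, lifting) mult_zero_right sum.neutral)
  then have *: "insert v \<tau> \<in> K" "card (insert v \<tau>) = Suc p"
    using c by (auto simp: supported_def)
  then have "\<tau> \<in> K" using K by (auto simp: simplicial_complex_def)
  moreover have "finite \<tau>" using * by (metis card.infinite finite_insert nat.distinct(1))
  ultimately show "\<tau> \<in> K \<and> card \<tau> = p" using * v by auto
qed

lemma boundary_boundary:
  assumes lt: "tournament lt" and K: "simplicial_complex U K" and c: "supported K p c"
  shows "boundary lt U (boundary lt U c) = (\<lambda>_. 0)"
proof
  fix \<tau>
  show "boundary lt U (boundary lt U c) \<tau> = 0"
  proof (cases "\<tau> \<subseteq> U")
    case False
    have "c (insert u (insert v \<tau>)) = 0" for u v
      using c K False by (auto simp: supported_def simplicial_complex_def)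
    then show ?thesis by (simp add: boundary_def)
  next
    case True
    have fin: "finite U" using K by (simp add: simplicial_complex_def)
    then have "finite \<tau>" using True by (rule rev_finite_subset)
    \<comment> \<open>The value 0 on the diagonal lets both indices range over
      \<open>U - \<tau>\<close>, so the two sums can be swapped; antisymmetry then makes the double
      sum equal to its own negative.\<close>
    define g where "g u v = (if u = v then 0 else incidence lt u (insert u \<tau>) *
       incidence lt v (insert v (insert u \<tau>)) * c (insert v (insert u \<tau>)))" for u v
    have anti: "g u v = - g v u" if "u \<in> U - \<tau>" "v \<in> U - \<tau>" for u v
      using incidence_anticommute[OF lt \<open>finite \<tau>\<close>, of u v] that
      by (auto simp: g_def insert_commute)
    have "boundary lt U (boundary lt U c) \<tau> = (\<Sum>u\<in>U - \<tau>. \<Sum>v\<in>U - \<tau>. g u v)"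
      unfolding boundary_def sum_distrib_left
    proof (rule sum.cong[OF refl])
      fix u assume "u \<in> U - \<tau>"
      show "(\<Sum>v\<in>U - insert u \<tau>. incidence lt u (insert u \<tau>) *
          (incidence lt v (insert v (insert u \<tau>)) * c (insert v (insert u \<tau>)))) = sum (g u) (U - \<tau>)"
        using fin by (intro sum.mono_neutral_cong_left) (auto simp: g_def mult.assoc)
    qed
    moreover have "(\<Sum>u\<in>U - \<tau>. \<Sum>v\<in>U - \<tau>. g u v) = - (\<Sum>u\<in>U - \<tau>. \<Sum>v\<in>U - \<tau>. g u v)"
      by (subst sum.swap, simp only: sum_negf[symmetric], intro sum.cong refl) (rule anti)
    ultimately show ?thesis by simp
  qed
qed

text \<open>This is the stretch of Mayer-Vietoris in which the homology of the intersection sits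
  between that of the union, one dimension higher, and those of \<open>A\<close> and
  \<open>B\<close>. A cycle on the intersection is filled on both sides; the difference of the
  fillings is a cycle of the union and bounds there.\<close>

lemma acyclic_at_Int:
  assumes lt: "tournament lt" and A: "simplicial_complex U A" and B: "simplicial_complex U B"
    and "acyclic_at lt U A p" "acyclic_at lt U B p" "acyclic_at lt U (A \<union> B) (Suc p)"
  shows "acyclic_at lt U (A \<inter> B) p"
  unfolding acyclic_at_def
proof (intro allI impI)
  fix z assume z: "supported (A \<inter> B) p z \<and> boundary lt U z = (\<lambda>_. 0)"
  then have "supported A p z" "supported B p z"
    by (auto intro: supported_mono)
  then obtain a b where a: "supported A (Suc p) a" "boundary lt U a = z"
    and b: "supported B (Suc p) b" "boundary lt U b = z"
    using assms z unfolding acyclic_at_def by meson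
  have "supported (A \<union> B) (Suc p) (\<lambda>\<sigma>. a \<sigma> - b \<sigma>)"
    using a b by (intro supported_diff) (auto intro: supported_mono)
  moreover have "boundary lt U (\<lambda>\<sigma>. a \<sigma> - b \<sigma>) = (\<lambda>_. 0)"
    using a b by (simp add: boundary_diff)
  ultimately obtain e where e: "supported (A \<union> B) (Suc (Suc p)) e"
      "boundary lt U e = (\<lambda>\<sigma>. a \<sigma> - b \<sigma>)"
    using assms(6) unfolding acyclic_at_def by meson
  \<comment> \<open>The bounding chain is cut in two: simplices lying in \<open>A\<close> go to
    \<open>e1\<close>, the remaining ones, necessarily in \<open>B\<close>, to
    \<open>e2\<close>.\<close>
  define e1 where "e1 \<sigma> = (if \<sigma> \<in> A then e \<sigma> else 0)" for \<sigma>
  define e2 where "e2 \<sigma> = (if \<sigma> \<in> A then 0 else e \<sigma>)" for \<sigma>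
  have e1: "supported A (Suc (Suc p)) e1" and e2: "supported B (Suc (Suc p)) e2"
    using e(1) by (auto simp: supported_def e1_def e2_def)
  have "(\<lambda>\<sigma>. e1 \<sigma> + e2 \<sigma>) = e" by (auto simp: e1_def e2_def)
  then have sum: "boundary lt U e1 \<sigma> + boundary lt U e2 \<sigma> = a \<sigma> - b \<sigma>" for \<sigma>
    using fun_cong[OF e(2), of \<sigma>] boundary_add[of lt U e1 e2] by simp
  \<comment> \<open>\<open>w\<close> equals both \<open>a - \<partial> e1\<close> and \<open>b + \<partial> e2\<close>, so it lives on \<open>A \<inter> B\<close>.\<close>
  define w where "w \<sigma> = a \<sigma> - boundary lt U e1 \<sigma>" for \<sigma>
  have w2: "w = (\<lambda>\<sigma>. b \<sigma> + boundary lt U e2 \<sigma>)"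
    using sum by (auto simp: w_def fun_eq_iff algebra_simps)
  have "supported A (Suc p) w"
    unfolding w_def using a e1 A by (intro supported_diff supported_boundary)
  moreover have "supported B (Suc p) w"
    unfolding w2 using b e2 B by (intro supported_add supported_boundary)
  ultimately have "supported (A \<inter> B) (Suc p) w"
    by (auto simp: supported_def)
  moreover have "boundary lt U w = z"
    unfolding w_def using a boundary_boundary[OF lt A e1] by (simp add: boundary_diff)
  ultimately show "\<exists>d. supported (A \<inter> B) (Suc p) d \<and> boundary lt U d = z" by blast
qed

text \<open>Coning with apex \<open>a\<close> contracts the open star of \<open>T\<close>.\<close>
lemma push_off_star:
  assumes lt: "tournament lt" and K: "simplicial_complex U K" and a: "a \<in> U" "a \<notin> T"
    and cone: "\<And>S. S \<in> K \<Longrightarrow> T \<subseteq> S \<Longrightarrow> insert a S \<in> K"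
    and x: "supported K p x" and dx: "\<And>S. T \<subseteq> S \<Longrightarrow> boundary lt U x S = 0"
  obtains y where "supported K (Suc p) y"
    "supported {S \<in> K. \<not> T \<subseteq> S} p (\<lambda>\<sigma>. x \<sigma> - boundary lt U y \<sigma>)"
proof -
  \<comment> \<open>\<open>y\<close> is the cone from \<open>a\<close> over the part of
    \<open>x\<close> in the star that avoids \<open>a\<close>. On a simplex containing
    \<open>T\<close> but not \<open>a\<close>, the only contribution to its boundary comes from
    adding \<open>a\<close>, and the sign is chosen so that this contribution equals
    \<open>x\<close>.\<close>
  define y where "y S = (if T \<subseteq> S \<and> a \<in> S then incidence lt a S * x (S - {a}) else 0)" for S
  define w where "w \<sigma> = x \<sigma> - boundary lt U y \<sigma>" for \<sigma>
  have finU: "finite U" using K by (simp add: simplicial_complex_def)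
  have single: "boundary lt U c \<tau> = incidence lt a (insert a \<tau>) * c (insert a \<tau>)"
    if "a \<notin> \<tau>" "\<And>v. v \<noteq> a \<Longrightarrow> v \<notin> \<tau> \<Longrightarrow> c (insert v \<tau>) = 0" for c \<tau>
  proof -
    have "boundary lt U c \<tau> = (\<Sum>v\<in>{a}. incidence lt v (insert v \<tau>) * c (insert v \<tau>))"
      unfolding boundary_def using finU a that by (intro sum.mono_neutral_right) auto
    then show ?thesis by simp
  qed
  have y: "supported K (Suc p) y"
    unfolding supported_def
  proof (intro allI impI)
    fix S assume "y S \<noteq> 0"
    then have S: "T \<subseteq> S" "a \<in> S" "x (S - {a}) \<noteq> 0" by (auto simp: y_def split: if_splits)
    then have S': "S - {a} \<in> K" "card (S - {a}) = p" using x by (auto simp: supported_def)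
    have "T \<subseteq> S - {a}" using S a by auto
    then have "insert a (S - {a}) \<in> K" using cone S' by blast
    then have "S \<in> K" using S by (simp add: insert_absorb)
    moreover have "finite S" using \<open>S \<in> K\<close> K by (auto simp: simplicial_complex_def intro: finite_subset)
    ultimately show "S \<in> K \<and> card S = Suc p" using S S'
      by (metis card_Suc_Diff1)
  qed
  have "supported K p w"
    unfolding w_def using x y K by (intro supported_diff supported_boundary)
  have w0: "w \<tau> = 0" if "T \<subseteq> \<tau>" "a \<notin> \<tau>" for \<tau>
  proof -
    have "boundary lt U y \<tau> = incidence lt a (insert a \<tau>) * y (insert a \<tau>)"
      using that by (intro single) (auto simp: y_def)
    also have "\<dots> = x \<tau>" using that by (simp add: y_def subset_insertI2 flip: mult.assoc)
    finally show ?thesis by (simp add: w_def)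
  qed
  \<comment> \<open>For \<open>\<tau>\<close> containing \<open>a\<close>, consider the facet
    \<open>\<tau> - {a}\<close>: every other coface of it omits \<open>a\<close> and has coefficient
    0 by \<open>w0\<close>, so the vanishing boundary of \<open>w\<close> there isolates the
    coefficient of \<open>\<tau>\<close>.\<close>
  have "w \<tau> = 0" if T: "T \<subseteq> \<tau>" for \<tau>
  proof (cases "a \<in> \<tau>")
    case True
    have T': "T \<subseteq> \<tau> - {a}" using T a by auto
    have "0 = boundary lt U w (\<tau> - {a})"
      using dx[OF T'] boundary_boundary[OF lt K y] by (simp add: w_def[abs_def] boundary_diff)
    also have "\<dots> = incidence lt a (insert a (\<tau> - {a})) * w (insert a (\<tau> - {a}))"
    proof (rule single)
      show "w (insert v (\<tau> - {a})) = 0" if "v \<noteq> a" for v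
        using that T' by (intro w0) auto
    qed simp
    also have "insert a (\<tau> - {a}) = \<tau>" using True by auto
    finally show ?thesis by simp
  qed (use w0 T in auto)
  then have "supported {S \<in> K. \<not> T \<subseteq> S} p w"
    using \<open>supported K p w\<close> by (auto simp: supported_def)
  then show thesis using that y unfolding w_def by blast
qed

text \<open>Chains are pushed off the star of \<open>T\<close> in both directions: a cycle of
  \<open>K\<close> is replaced by a homologous one, and a filling in \<open>K\<close> of a cycle
  that avoids the star is changed by a boundary. The second use is why \<open>push_off_star\<close>
  asks for a vanishing boundary only on the star.\<close>

lemma acyclic_at_delete_star:
  assumes lt: "tournament lt" and K: "simplicial_complex U K" and a: "a \<in> U" "a \<notin> T"
    and cone: "\<And>S. S \<in> K \<Longrightarrow> T \<subseteq> S \<Longrightarrow> insert a S \<in> K"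
  shows "acyclic_at lt U {S \<in> K. \<not> T \<subseteq> S} p \<longleftrightarrow> acyclic_at lt U K p"
proof
  assume L: "acyclic_at lt U {S \<in> K. \<not> T \<subseteq> S} p"
  show "acyclic_at lt U K p"
    unfolding acyclic_at_def
  proof (intro allI impI)
    fix z assume z: "supported K p z \<and> boundary lt U z = (\<lambda>_. 0)"
    obtain y where y: "supported K (Suc p) y"
        "supported {S \<in> K. \<not> T \<subseteq> S} p (\<lambda>\<sigma>. z \<sigma> - boundary lt U y \<sigma>)"
      by (rule push_off_star[OF lt K a cone, of p z]) (use z in auto)
    have "boundary lt U (\<lambda>\<sigma>. z \<sigma> - boundary lt U y \<sigma>) = (\<lambda>_. 0)"
      using z boundary_boundary[OF lt K y(1)] by (simp add: boundary_diff)
    then obtain d where d: "supported {S \<in> K. \<not> T \<subseteq> S} (Suc p) d"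
        "boundary lt U d = (\<lambda>\<sigma>. z \<sigma> - boundary lt U y \<sigma>)"
      using L y(2) unfolding acyclic_at_def by meson
    have "supported K (Suc p) (\<lambda>\<sigma>. d \<sigma> + y \<sigma>)"
      using d y by (intro supported_add) (auto intro: supported_mono)
    moreover have "boundary lt U (\<lambda>\<sigma>. d \<sigma> + y \<sigma>) = z"
      using d by (simp add: boundary_add)
    ultimately show "\<exists>d. supported K (Suc p) d \<and> boundary lt U d = z" by blast
  qed
next
  assume L: "acyclic_at lt U K p"
  show "acyclic_at lt U {S \<in> K. \<not> T \<subseteq> S} p"
    unfolding acyclic_at_def
  proof (intro allI impI)
    fix z assume z: "supported {S \<in> K. \<not> T \<subseteq> S} p z \<and> boundary lt U z = (\<lambda>_. 0)"
    then have "supported K p z" by (auto intro: supported_mono)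
    then obtain d where d: "supported K (Suc p) d" "boundary lt U d = z"
      using L z unfolding acyclic_at_def by meson
    obtain y where y: "supported K (Suc (Suc p)) y"
        "supported {S \<in> K. \<not> T \<subseteq> S} (Suc p) (\<lambda>\<sigma>. d \<sigma> - boundary lt U y \<sigma>)"
      by (rule push_off_star[OF lt K a cone, of "Suc p" d])
        (use d z in \<open>auto simp: supported_def\<close>)
    have "boundary lt U (\<lambda>\<sigma>. d \<sigma> - boundary lt U y \<sigma>) = z"
      using d boundary_boundary[OF lt K y(1)] by (simp add: boundary_diff)
    then show "\<exists>d. supported {S \<in> K. \<not> T \<subseteq> S} (Suc p) d \<and> boundary lt U d = z"
      using y(2) by blast
  qed
qed

section \<open>Relabelling vertices along an injection\<close>

lemma boundary_image:
  assumes f: "inj f" and lt: "\<And>u v. lt' (f u) (f v) = lt u v"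
    and K: "K \<subseteq> Pow U" and U': "finite U'" "f ` U \<subseteq> U'"
    and c: "supported ((`) f ` K) p c"
  shows "boundary lt' U' c (f ` \<tau>) = boundary lt U (\<lambda>\<sigma>. c (f ` \<sigma>)) \<tau>"
proof -
  have inc: "incidence lt' (f v) (f ` \<sigma>) = incidence lt v \<sigma>" for v \<sigma>
  proof -
    have "{u \<in> f ` \<sigma>. lt' u (f v)} = f ` {u \<in> \<sigma>. lt u v}" using lt by auto
    then show ?thesis using f by (simp add: incidence_def card_image inj_on_subset)
  qed
  have "boundary lt' U' c (f ` \<tau>) =
      (\<Sum>v\<in>f ` (U - \<tau>). incidence lt' v (insert v (f ` \<tau>)) * c (insert v (f ` \<tau>)))"
    unfolding boundary_def
  proof (intro sum.mono_neutral_right ballI)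
    show "f ` (U - \<tau>) \<subseteq> U' - f ` \<tau>" using f U' by (auto dest: injD)
    fix v assume v: "v \<in> U' - f ` \<tau> - f ` (U - \<tau>)"
    \<comment> \<open>A vertex \<open>v\<close> in neither image is not the image of any element of
      \<open>U\<close>, so no simplex of the image complex contains it.\<close>
    have "insert v (f ` \<tau>) \<notin> (`) f ` K"
    proof
      assume "insert v (f ` \<tau>) \<in> (`) f ` K"
      then obtain \<sigma> where \<sigma>: "\<sigma> \<in> K" "insert v (f ` \<tau>) = f ` \<sigma>" by blast
      then obtain u where "u \<in> \<sigma>" "v = f u" by blast
      then show False using v K \<sigma>(1) by auto
    qed
    then show "incidence lt' v (insert v (f ` \<tau>)) * c (insert v (f ` \<tau>)) = 0"
      using c by (auto simp: supported_def)
  qed (use U' in auto)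
  also have "\<dots> = (\<Sum>v\<in>U - \<tau>. incidence lt' (f v) (f ` insert v \<tau>) * c (f ` insert v \<tau>))"
    using inj_on_subset[OF f subset_UNIV] by (subst sum.reindex) auto
  finally show ?thesis by (simp add: boundary_def inc del: image_insert)
qed

lemma acyclic_at_image:
  fixes f :: "'a \<Rightarrow> 'b"
  assumes f: "inj f" and lt: "\<And>u v. lt' (f u) (f v) = lt u v"
    and K: "simplicial_complex U K" and U': "finite U'" "f ` U \<subseteq> U'"
  shows "acyclic_at lt' U' ((`) f ` K) p \<longleftrightarrow> acyclic_at lt U K p"
proof -
  \<comment> \<open>Extension by zero: sets that are not images carry no coefficient, and on images
    \<open>push\<close> inverts the pullback along \<open>f\<close>.\<close>
  define push :: "('a set \<Rightarrow> rat) \<Rightarrow> 'b set \<Rightarrow> rat"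
    where "push c \<sigma> = (if \<sigma> \<in> range ((`) f) then c (f -` \<sigma>) else 0)" for c \<sigma>
  have KU: "K \<subseteq> Pow U" using K by (simp add: simplicial_complex_def)
  have bd: "boundary lt' U' c (f ` \<tau>) = boundary lt U (\<lambda>\<sigma>. c (f ` \<sigma>)) \<tau>"
    if "supported ((`) f ` K) q c" for c q \<tau>
    by (rule boundary_image[where K = K and p = q]) (use f lt KU U' that in auto)
  have push [simp]: "push c (f ` \<sigma>) = c \<sigma>" for c \<sigma>
    using f by (simp add: push_def inj_vimage_image_eq)
  have supp_push: "supported ((`) f ` K) q (push c)" if "supported K q c" for q c
    using that f by (auto simp: supported_def push_def inj_vimage_image_eq card_image inj_on_subset)
  have supp_pull: "supported K q (\<lambda>\<sigma>. c (f ` \<sigma>))" if "supported ((`) f ` K) q c" for q c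
    using that f by (auto simp: supported_def card_image inj_on_subset inj_image_eq_iff)
  have K': "simplicial_complex U' ((`) f ` K)"
    using K U' by (auto simp: simplicial_complex_def subset_image_iff)
  \<comment> \<open>Subsets of an image are images, so a set that is not an image has no coface in
    the image complex.\<close>
  have off: "boundary lt' U' c \<tau> = 0" if "supported ((`) f ` K) q c" "\<tau> \<notin> range ((`) f)" for c \<tau> q
  proof -
    have "insert v \<tau> \<notin> (`) f ` K" for v
      using that(2) by (metis imageE rangeI subset_imageE subset_insertI)
    then have "c (insert v \<tau>) = 0" for v using that(1) unfolding supported_def by metis
    then show ?thesis by (simp add: boundary_def)
  qed
  show ?thesis
  proof
    assume L: "acyclic_at lt' U' ((`) f ` K) p"
    show "acyclic_at lt U K p"
      unfolding acyclic_at_def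
    proof (intro allI impI)
      fix z assume z: "supported K p z \<and> boundary lt U z = (\<lambda>_. 0)"
      have "boundary lt' U' (push z) \<tau> = 0" for \<tau>
        using off[OF supp_push] bd[OF supp_push, of p z] z by (cases "\<tau> \<in> range ((`) f)") auto
      then obtain d where d: "supported ((`) f ` K) (Suc p) d" "boundary lt' U' d = push z"
        using L z supp_push[of p z] unfolding acyclic_at_def by blast
      have "boundary lt U (\<lambda>\<sigma>. d (f ` \<sigma>)) = z"
        using bd[OF d(1)] d(2) by (simp add: fun_eq_iff)
      then show "\<exists>d. supported K (Suc p) d \<and> boundary lt U d = z"
        using supp_pull[OF d(1)] by blast
    qed
  next
    assume L: "acyclic_at lt U K p"
    show "acyclic_at lt' U' ((`) f ` K) p"
      unfolding acyclic_at_def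
    proof (intro allI impI)
      fix z assume z: "supported ((`) f ` K) p z \<and> boundary lt' U' z = (\<lambda>_. 0)"
      have "boundary lt U (\<lambda>\<sigma>. z (f ` \<sigma>)) = (\<lambda>_. 0)"
        using bd[of p z] z by (auto simp: fun_eq_iff)
      then obtain d where d: "supported K (Suc p) d" "boundary lt U d = (\<lambda>\<sigma>. z (f ` \<sigma>))"
        using L z supp_pull[of p z] unfolding acyclic_at_def by blast
      have "boundary lt' U' (push d) \<tau> = z \<tau>" for \<tau>
      proof (cases "\<tau> \<in> range ((`) f)")
        case True
        then show ?thesis using bd[OF supp_push[OF d(1)]] d(2) by auto
      next
        case False
        then have "z \<tau> = 0" using z by (auto simp: supported_def)
        then show ?thesis using off[OF supp_push[OF d(1)] False] by simp
      qed
      then show "\<exists>d. supported ((`) f ` K) (Suc p) d \<and> boundary lt' U' d = z"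
        using supp_push[OF d(1)] by blast
    qed
  qed
qed


section \<open>Connectivity in terms of ungraded chains\<close>

definition vorder_lt :: "'a \<Rightarrow> 'a \<Rightarrow> bool" where
  "vorder_lt u v \<longleftrightarrow> (u, v) \<in> vorder \<and> u \<noteq> v"

lemma tournament_vorder_lt: "tournament (vorder_lt :: 'a \<Rightarrow> 'a \<Rightarrow> bool)"
proof -
  have "\<exists>r :: 'a rel. well_order_on UNIV r" by (rule well_order_on)
  then have "well_order_on UNIV (vorder :: 'a rel)"
    unfolding vorder_def by (rule someI_ex)
  then have "total (vorder :: 'a rel)" "antisym (vorder :: 'a rel)"
    by (simp_all add: well_order_on_def linear_order_on_def partial_order_on_def)
  then show ?thesis
    unfolding tournament_def vorder_lt_def total_on_def antisym_def by blast
qed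

lemma face_sign_eq_incidence: "face_sign = incidence vorder_lt"
  by (simp add: fun_eq_iff face_sign_def incidence_def vorder_lt_def)

text \<open>\<open>faces\<close> counts the empty set even when \<open>K\<close> itself is empty;
  this is the source of \<open>insert {} K\<close> in the translation of reduced homology.\<close>

lemma faces_eq:
  assumes "simplicial_complex U K"
  shows "faces K j = {\<sigma> \<in> insert {} K. int (card \<sigma>) = j + 1}"
  using assms by (auto simp: faces_def simplicial_complex_def intro: finite_subset)

lemma is_chain_iff_supported:
  assumes "simplicial_complex U K"
  shows "is_chain K (int p - 1) c \<longleftrightarrow> supported (insert {} K) p c"
  by (auto simp: is_chain_def supported_def faces_eq[OF assms])

text \<open>Cofaces of \<open>\<tau>\<close> with one more vertex correspond to the vertices that
  can be added to it. Off the faces of the right dimension, \<open>bdry\<close> is 0 by definition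
  and \<open>boundary\<close> is 0 because of the support of \<open>c\<close>.\<close>

lemma bdry_eq_boundary:
  assumes K: "simplicial_complex U K" and c: "supported (insert {} K) p c"
  shows "bdry K (int p - 1) c = boundary vorder_lt U c"
proof
  fix \<tau>
  let ?K = "insert {} K"
  have K0: "simplicial_complex U ?K" using K by (auto simp: simplicial_complex_def)
  have fin: "finite \<sigma>" if "\<sigma> \<in> ?K" for \<sigma>
    using K0 that by (auto simp: simplicial_complex_def intro: finite_subset)
  show "bdry K (int p - 1) c \<tau> = boundary vorder_lt U c \<tau>"
  proof (cases "\<tau> \<in> faces K (int p - 1 - 1)")
    case True
    then have \<tau>: "\<tau> \<in> ?K" "Suc (card \<tau>) = p" by (auto simp: faces_eq[OF K])
    define A where "A = {v \<in> U - \<tau>. insert v \<tau> \<in> ?K}"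
    have "{\<sigma> \<in> faces K (int p - 1). \<tau> \<subseteq> \<sigma>} = (\<lambda>v. insert v \<tau>) ` A"
    proof (intro equalityI subsetI)
      fix \<sigma> assume "\<sigma> \<in> {\<sigma> \<in> faces K (int p - 1). \<tau> \<subseteq> \<sigma>}"
      then have \<sigma>: "\<sigma> \<in> ?K" "card \<sigma> = p" "\<tau> \<subseteq> \<sigma>" by (auto simp: faces_eq[OF K])
      then have "card (\<sigma> - \<tau>) = 1" using \<tau> fin by (simp add: card_Diff_subset)
      then obtain v where "\<sigma> - \<tau> = {v}" by (auto simp: card_1_singleton_iff)
      then have "\<sigma> = insert v \<tau>" "v \<notin> \<tau>" using \<sigma> by auto
      then show "\<sigma> \<in> (\<lambda>v. insert v \<tau>) ` A"
        using \<sigma>(1) K0 by (auto simp: A_def simplicial_complex_def)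
    next
      fix \<sigma> assume "\<sigma> \<in> (\<lambda>v. insert v \<tau>) ` A"
      then show "\<sigma> \<in> {\<sigma> \<in> faces K (int p - 1). \<tau> \<subseteq> \<sigma>}"
        using \<tau>(2) fin[OF \<tau>(1)] by (auto simp: A_def faces_eq[OF K])
    qed
    moreover have "inj_on (\<lambda>v. insert v \<tau>) A" by (auto simp: A_def inj_on_def)
    moreover have "insert v \<tau> - \<tau> = {v}" if "v \<in> A" for v
      using that by (auto simp: A_def)
    ultimately have "bdry K (int p - 1) c \<tau> =
        (\<Sum>v\<in>A. incidence vorder_lt v (insert v \<tau>) * c (insert v \<tau>))"
      using True by (simp add: bdry_def sum.reindex face_sign_eq_incidence)
    also have "\<dots> = boundary vorder_lt U c \<tau>"
      unfolding boundary_def using K c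
      by (intro sum.mono_neutral_left) (auto simp: A_def simplicial_complex_def supported_def)
    finally show ?thesis .
  next
    case False
    have "boundary vorder_lt U c \<tau> = 0"
    proof (cases p)
      case 0
      \<comment> \<open>With \<open>p = 0\<close> only the empty set can carry
        \<open>c\<close>.\<close>
      have "c (insert v \<tau>) = 0" for v
        using c fin[of "insert v \<tau>"] 0 by (auto simp: supported_def)
      then show ?thesis by (simp add: boundary_def)
    next
      case (Suc q)
      then have "supported ?K q (boundary vorder_lt U c)"
        using supported_boundary[OF K0] c by simp
      moreover have "\<not> (\<tau> \<in> ?K \<and> card \<tau> = q)"
        using False Suc by (simp add: faces_eq[OF K])
      ultimately show ?thesis unfolding supported_def by blast
    qed
    then show ?thesis using False by (simp add: bdry_def)
  qed
qed

lemma red_hom_vanishes_iff_acyclic_at: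
  assumes K: "simplicial_complex U K"
  shows "red_hom_vanishes K (int p - 1) \<longleftrightarrow> acyclic_at vorder_lt U (insert {} K) p"
proof -
  have eq: "is_chain K (int q - 1) c \<and> (\<forall>\<tau>. bdry K (int q - 1) c \<tau> = b \<tau>) \<longleftrightarrow>
      supported (insert {} K) q c \<and> boundary vorder_lt U c = b" for q c b
    using bdry_eq_boundary[OF K, of q c] is_chain_iff_supported[OF K, of q c] by auto
  have p: "int p - 1 + 1 = int (Suc p) - 1" by simp
  show ?thesis
    unfolding red_hom_vanishes_def acyclic_at_def p eq eq[where b = "\<lambda>_. 0"] by (rule refl)
qed

text \<open>The condition on \<open>n\<close> in \<open>eta_H\<close> is inherited by smaller
  \<open>n\<close>, so its failure at \<open>n\<close> bounds the supremum by \<open>n - 1\<close>;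
  this also covers an infinite supremum. The range of \<open>j\<close> from -1 to
  \<open>n - 2\<close> is that of \<open>p - 1\<close> for \<open>p < n\<close>.\<close>

lemma enat_le_eta_H_iff:
  assumes K: "simplicial_complex U K"
  shows "enat n \<le> eta_H K \<longleftrightarrow> (\<forall>p<n. acyclic_at vorder_lt U (insert {} K) p)"
proof -
  define Q where "Q n \<longleftrightarrow> (\<forall>p<n. acyclic_at vorder_lt U (insert {} K) p)" for n
  have "(\<forall>j::int. -1 \<le> j \<and> j \<le> int n - 2 \<longrightarrow> red_hom_vanishes K j) \<longleftrightarrow> Q n" for n
  proof -
    have "(\<forall>j::int. -1 \<le> j \<and> j \<le> int n - 2 \<longrightarrow> red_hom_vanishes K j) \<longleftrightarrow>
        (\<forall>p<n. red_hom_vanishes K (int p - 1))"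
    proof (intro iffI allI impI)
      fix j assume *: "\<forall>p<n. red_hom_vanishes K (int p - 1)" "-1 \<le> j \<and> j \<le> int n - 2"
      then have "nat (j + 1) < n" "int (nat (j + 1)) - 1 = j" by auto
      then show "red_hom_vanishes K j" using *(1) by metis
    qed auto
    then show ?thesis by (simp add: red_hom_vanishes_iff_acyclic_at[OF K] Q_def)
  qed
  then have eta: "eta_H K = Sup {enat n | n. Q n}" by (simp only: eta_H_def)
  have "enat n \<le> eta_H K \<longleftrightarrow> Q n"
  proof
    assume n: "enat n \<le> eta_H K"
    show "Q n"
    proof (rule ccontr)
      assume "\<not> Q n"
      then have "q < n" if "Q q" for q
        using that unfolding Q_def by (meson less_le_trans not_less)
      moreover obtain l where l: "n = Suc l" using \<open>\<not> Q n\<close> by (cases n) (auto simp: Q_def)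
      ultimately have "eta_H K \<le> enat l"
        unfolding eta by (intro Sup_least) (auto simp: less_Suc_eq_le)
      then show False using n l by (metis enat_ord_simps(1) not_less_eq_eq order.refl order_trans)
    qed
  next
    assume "Q n"
    then show "enat n \<le> eta_H K" unfolding eta by (intro Sup_upper) blast
  qed
  then show ?thesis by (simp add: Q_def)
qed

section \<open>Order complexes\<close>

definition order_complex :: "'a set set \<Rightarrow> 'a set set set" where
  "order_complex P = {S. S \<subseteq> P \<and> (\<forall>a\<in>S. \<forall>b\<in>S. a \<subseteq> b \<or> b \<subseteq> a)}"

lemma simplicial_complex_order_complex: "finite U \<Longrightarrow> P \<subseteq> U \<Longrightarrow> simplicial_complex U (order_complex P)"
  unfolding simplicial_complex_def order_complex_def by blast

lemma order_complex_downward: "S \<in> order_complex P \<Longrightarrow> T \<subseteq> S \<Longrightarrow> T \<in> order_complex P"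
  unfolding order_complex_def by blast

lemma order_complex_Int: "order_complex (A \<inter> B) = order_complex A \<inter> order_complex B"
  by (auto simp: order_complex_def)

text \<open>A nonempty finite chain has a least element. If that lies in \<open>A\<close>, upward
  closure carries the whole chain into \<open>A\<close>, and likewise for \<open>B\<close>.\<close>

lemma order_complex_Un:
  assumes C: "finite C" "A \<subseteq> C" "B \<subseteq> C"
    and A: "\<And>\<sigma> \<tau>. \<sigma> \<in> A \<Longrightarrow> \<tau> \<in> C \<Longrightarrow> \<sigma> \<subseteq> \<tau> \<Longrightarrow> \<tau> \<in> A"
    and B: "\<And>\<sigma> \<tau>. \<sigma> \<in> B \<Longrightarrow> \<tau> \<in> C \<Longrightarrow> \<sigma> \<subseteq> \<tau> \<Longrightarrow> \<tau> \<in> B"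
  shows "order_complex (A \<union> B) = order_complex A \<union> order_complex B"
proof
  show "order_complex (A \<union> B) \<subseteq> order_complex A \<union> order_complex B"
  proof
    fix S assume S: "S \<in> order_complex (A \<union> B)"
    show "S \<in> order_complex A \<union> order_complex B"
    proof (cases "S = {}")
      case False
      have "finite S" using S C by (auto simp: order_complex_def intro: finite_subset)
      then obtain \<mu> where \<mu>: "\<mu> \<in> S" "\<forall>\<sigma>\<in>S. \<sigma> \<subseteq> \<mu> \<longrightarrow> \<mu> = \<sigma>"
        using finite_has_minimal False by metis
      then have least: "\<mu> \<subseteq> \<sigma>" if "\<sigma> \<in> S" for \<sigma>
      proof -
        have "\<mu> \<subseteq> \<sigma> \<or> \<sigma> \<subseteq> \<mu>" using S \<mu>(1) that by (simp add: order_complex_def)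
        then show ?thesis using \<mu>(2) that by auto
      qed
      have "S \<subseteq> C" using S C by (auto simp: order_complex_def)
      then have "\<mu> \<in> A \<Longrightarrow> S \<subseteq> A" "\<mu> \<in> B \<Longrightarrow> S \<subseteq> B"
        using A[of \<mu>] B[of \<mu>] least by (meson subset_eq)+
      moreover have "\<mu> \<in> A \<or> \<mu> \<in> B" using S \<mu>(1) by (auto simp: order_complex_def)
      ultimately show ?thesis using S by (auto simp: order_complex_def)
    qed (simp add: order_complex_def)
  qed
qed (auto simp: order_complex_def)

section \<open>Comparison of a complex with an order complex through a cylinder\<close>

definition sum_lt :: "('a \<Rightarrow> 'a \<Rightarrow> bool) \<Rightarrow> ('b \<Rightarrow> 'b \<Rightarrow> bool) \<Rightarrow> 'a + 'b \<Rightarrow> 'a + 'b \<Rightarrow> bool" where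
  "sum_lt l r x y \<longleftrightarrow> (case x of
     Inl a \<Rightarrow> (case y of Inl b \<Rightarrow> l a b | Inr _ \<Rightarrow> True)
   | Inr a \<Rightarrow> (case y of Inl _ \<Rightarrow> False | Inr b \<Rightarrow> r a b))"

lemma tournament_sum_lt:
  assumes "tournament l" "tournament r"
  shows "tournament (sum_lt l r)"
  unfolding tournament_def
proof (intro conjI allI impI)
  show "\<not> sum_lt l r u u" for u
    using assms by (cases u) (simp_all add: sum_lt_def tournament_def)
  have total: "l a b" if "\<not> l b a" "a \<noteq> b" for a b
    using assms(1) that unfolding tournament_def by blast
  have asym: False if "l a b" "l b a" for a b
    using assms(1) that unfolding tournament_def by metis
  have total': "r a b" if "\<not> r b a" "a \<noteq> b" for a b
    using assms(2) that unfolding tournament_def by blast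
  have asym': False if "r a b" "r b a" for a b
    using assms(2) that unfolding tournament_def by metis
  show "sum_lt l r u v \<longleftrightarrow> \<not> sum_lt l r v u" if "u \<noteq> v" for u v
    using that
    by (cases u; cases v) (auto simp: sum_lt_def intro: total total' dest: asym asym')
qed

text \<open>A mapping cylinder joining \<open>L\<close> to the order complex of \<open>P\<close>; it collapses to either end.\<close>
definition cylinder :: "'a set set \<Rightarrow> 'a set set \<Rightarrow> ('a + 'a set) set set" where
  "cylinder L P = {W. Inl -` W \<in> L \<and> Inr -` W \<in> order_complex P \<and> (\<forall>\<sigma>. Inr \<sigma> \<in> W \<longrightarrow> Inl -` W \<subseteq> \<sigma>)}"

lemma simplicial_complex_cylinder:
  assumes L: "simplicial_complex V L" and U: "finite U" "P \<subseteq> U"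
  shows "simplicial_complex (Inl ` V \<union> Inr ` U) (cylinder L P)"
  unfolding simplicial_complex_def
proof (intro conjI ballI allI impI subsetI PowI)
  show "finite (Inl ` V \<union> Inr ` U)" using L U by (simp add: simplicial_complex_def)
next
  fix W x assume "W \<in> cylinder L P" "x \<in> W"
  then have "Inl -` W \<in> L" "Inr -` W \<subseteq> P" by (simp_all add: cylinder_def order_complex_def)
  moreover have "L \<subseteq> Pow V" using L by (simp add: simplicial_complex_def)
  ultimately have "Inl -` W \<in> Pow V" "Inr -` W \<subseteq> U" using U(2) by (meson subsetD order.trans)+
  then show "x \<in> Inl ` V \<union> Inr ` U" using \<open>x \<in> W\<close> by (cases x) auto
next
  fix W W' assume W: "W \<in> cylinder L P" and sub: "W' \<subseteq> W"
  have *: "Inl -` W' \<subseteq> Inl -` W" "Inr -` W' \<subseteq> Inr -` W" using sub by auto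
  have "Inl -` W \<in> L" "Inr -` W \<in> order_complex P" using W by (simp_all add: cylinder_def)
  then have "Inl -` W' \<in> L" "Inr -` W' \<in> order_complex P"
    using simplicial_complex_downward[OF L _ *(1)] order_complex_downward[OF _ *(2)] by simp_all
  moreover have "Inl -` W' \<subseteq> \<sigma>" if "Inr \<sigma> \<in> W'" for \<sigma>
    using W that sub *(1) unfolding cylinder_def by blast
  ultimately show "W' \<in> cylinder L P" by (simp add: cylinder_def)
qed

text \<open>A fibre argument: by \<open>apex\<close>, the simplices of \<open>L\<close> inside any
  \<open>\<sigma>\<close> in \<open>P\<close> form a cone, and by \<open>LP\<close> each nonempty
  simplex of \<open>L\<close> is itself an element of \<open>P\<close>. Star deletions shrink the
  cylinder to \<open>L\<close> by the first fact and to the order complex by the second.\<close>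

lemma acyclic_at_order_complex_iff:
  assumes lt: "tournament lt" "tournament lt'"
    and L: "simplicial_complex V L" "{} \<in> L" and U: "finite U" "P \<subseteq> U"
    and LP: "\<And>\<tau>. \<tau> \<in> L \<Longrightarrow> \<tau> \<noteq> {} \<Longrightarrow> \<tau> \<in> P"
    and apex: "\<And>\<sigma>. \<sigma> \<in> P \<Longrightarrow> \<exists>v\<in>\<sigma> \<inter> V. \<forall>\<tau>\<in>L. \<tau> \<subseteq> \<sigma> \<longrightarrow> insert v \<tau> \<in> L"
  shows "acyclic_at lt' U (order_complex P) p \<longleftrightarrow> acyclic_at lt V L p"
proof -
  define W where "W = Inl ` V \<union> Inr ` U"
  define ac where "ac K \<longleftrightarrow> acyclic_at (sum_lt lt lt') W K p" for K
  \<comment> \<open>The summed order restricts to \<open>lt\<close> and \<open>lt'\<close> on the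
    two ends, as their identification with relabelled copies requires.\<close>
  have lts: "tournament (sum_lt lt lt')" using lt by (rule tournament_sum_lt)
  have W: "finite W" "Inl ` V \<subseteq> W" "Inr ` U \<subseteq> W"
    using L U by (auto simp: W_def simplicial_complex_def)
  have "finite L" using L by (auto simp: simplicial_complex_def intro: finite_subset)
  \<comment> \<open>Delete the vertices \<open>Inr \<sigma>\<close> in order of increasing \<open>\<sigma>\<close>: then the link of \<open>Inr \<sigma>\<close> is a cone
    with apex a vertex of \<open>\<sigma>\<close>.\<close>
  have add: "R \<subseteq> P \<longrightarrow> (ac (cylinder L R) \<longleftrightarrow> ac (cylinder L {}))" if "finite R" for R
    using that
  proof (induction R rule: finite_psubset_induct)
    case (psubset R)
    show ?case
    proof (cases "R = {}")
      case False
      obtain \<sigma> where \<sigma>: "\<sigma> \<in> R" "\<forall>\<rho>\<in>R. \<rho> \<subseteq> \<sigma> \<longrightarrow> \<sigma> = \<rho>"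
        using finite_has_minimal[OF psubset.hyps(1) False] by metis
      show ?thesis
      proof
        assume R: "R \<subseteq> P"
        then obtain v where "v \<in> \<sigma> \<inter> V" "\<forall>\<tau>\<in>L. \<tau> \<subseteq> \<sigma> \<longrightarrow> insert v \<tau> \<in> L"
          using apex[OF subsetD[OF R \<sigma>(1)]] by (elim bexE)
        then have v: "v \<in> \<sigma>" "v \<in> V" "\<And>\<tau>. \<tau> \<in> L \<Longrightarrow> \<tau> \<subseteq> \<sigma> \<Longrightarrow> insert v \<tau> \<in> L"
          by simp_all
        have R': "finite U" "R \<subseteq> U" using R U by auto
        have "acyclic_at (sum_lt lt lt') W {S \<in> cylinder L R. \<not> {Inr \<sigma>} \<subseteq> S} p
            \<longleftrightarrow> ac (cylinder L R)"
          unfolding ac_def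
        proof (rule acyclic_at_delete_star[OF lts, where a = "Inl v"])
          show "simplicial_complex W (cylinder L R)"
            unfolding W_def using L(1) R' by (rule simplicial_complex_cylinder)
          fix S assume S: "S \<in> cylinder L R" "{Inr \<sigma>} \<subseteq> S"
          have "Inl -` insert (Inl v) S = insert v (Inl -` S)" "Inr -` insert (Inl v) S = Inr -` S"
            by auto
          \<comment> \<open>Minimality of \<open>\<sigma>\<close> in \<open>R\<close> puts the whole
            chain above it, so the new vertex \<open>v\<close> of \<open>\<sigma>\<close> meets the
            containment condition for each member.\<close>
          moreover have "\<sigma> \<subseteq> \<rho>" if "Inr \<rho> \<in> S" for \<rho>
          proof -
            have "\<sigma> \<in> Inr -` S" "\<rho> \<in> Inr -` S" using S(2) that by auto
            then have "\<rho> \<in> R" "\<sigma> \<subseteq> \<rho> \<or> \<rho> \<subseteq> \<sigma>"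
              using S(1) unfolding cylinder_def order_complex_def by auto
            then show ?thesis using \<sigma>(2) by auto
          qed
          moreover have "Inl -` S \<in> L" "Inl -` S \<subseteq> \<sigma>" using S by (auto simp: cylinder_def)
          ultimately show "insert (Inl v) S \<in> cylinder L R"
            using S(1) v(1) v(3)[of "Inl -` S"] by (auto simp: cylinder_def)
        qed (use v W in auto)
        moreover have "{S \<in> cylinder L R. \<not> {Inr \<sigma>} \<subseteq> S} = cylinder L (R - {\<sigma>})"
          by (auto simp: cylinder_def order_complex_def)
        moreover have "ac (cylinder L (R - {\<sigma>})) \<longleftrightarrow> ac (cylinder L {})"
          using psubset.IH[of "R - {\<sigma>}"] \<sigma>(1) R by blast
        ultimately show "ac (cylinder L R) \<longleftrightarrow> ac (cylinder L {})"
          by (simp add: ac_def)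
      qed
    qed simp
  qed
  \<comment> \<open>Delete the simplices \<open>Inl ` \<tau>\<close> in order of decreasing \<open>\<tau>\<close>: then the link of \<open>Inl ` \<tau>\<close> is a
    cone with apex \<open>Inr \<tau>\<close>.\<close>
  have remove: "Q \<subseteq> L \<longrightarrow> {} \<in> Q \<longrightarrow> (\<forall>\<tau>\<in>Q. \<forall>\<rho>. \<rho> \<subseteq> \<tau> \<longrightarrow> \<rho> \<in> Q) \<longrightarrow>
      (ac (cylinder Q P) \<longleftrightarrow> ac (cylinder {{}} P))" if "finite Q" for Q
    using that
  proof (induction Q rule: finite_psubset_induct)
    case (psubset Q)
    show ?case
    proof (intro impI)
      assume Q: "Q \<subseteq> L" "{} \<in> Q" "\<forall>\<tau>\<in>Q. \<forall>\<rho>. \<rho> \<subseteq> \<tau> \<longrightarrow> \<rho> \<in> Q"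
      show "ac (cylinder Q P) \<longleftrightarrow> ac (cylinder {{}} P)"
      proof (cases "Q = {{}}")
        case False
        obtain \<tau> where \<tau>: "\<tau> \<in> Q" "\<forall>\<rho>\<in>Q. \<tau> \<subseteq> \<rho> \<longrightarrow> \<tau> = \<rho>"
          using finite_has_maximal[OF psubset.hyps(1)] Q(2) by (metis emptyE)
        have "\<tau> \<noteq> {}" using \<tau> Q(2) False by blast
        then have "\<tau> \<in> P" using LP \<tau>(1) Q(1) by blast
        have Q': "simplicial_complex V Q"
          using L(1) Q unfolding simplicial_complex_def by blast
        \<comment> \<open>Maximality of \<open>\<tau>\<close> in \<open>Q\<close> excludes anything
          larger on the \<open>Inl\<close> side, so deleting the star amounts to removing the single
          simplex \<open>\<tau>\<close> from \<open>Q\<close>.\<close>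
        have top: "Inl -` S = \<tau>" if "S \<in> cylinder Q P" "Inl ` \<tau> \<subseteq> S" for S
        proof -
          have "Inl -` S \<in> Q" "\<tau> \<subseteq> Inl -` S" using that by (auto simp: cylinder_def)
          then show ?thesis using \<tau>(2) by metis
        qed
        have "acyclic_at (sum_lt lt lt') W {S \<in> cylinder Q P. \<not> Inl ` \<tau> \<subseteq> S} p
            \<longleftrightarrow> ac (cylinder Q P)"
          unfolding ac_def
        proof (rule acyclic_at_delete_star[OF lts, where a = "Inr \<tau>"])
          show "simplicial_complex W (cylinder Q P)"
            unfolding W_def using Q' U by (rule simplicial_complex_cylinder)
          fix S assume S: "S \<in> cylinder Q P" "Inl ` \<tau> \<subseteq> S"
          have "Inl -` insert (Inr \<tau>) S = Inl -` S" "Inr -` insert (Inr \<tau>) S = insert \<tau> (Inr -` S)"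
            by auto
          moreover have "\<tau> \<subseteq> \<rho>" if "Inr \<rho> \<in> S" for \<rho>
            using S(1) that top[OF S] by (simp add: cylinder_def)
          then have "insert \<tau> (Inr -` S) \<in> order_complex P"
            using S(1) \<open>\<tau> \<in> P\<close> by (simp add: cylinder_def order_complex_def)
          ultimately show "insert (Inr \<tau>) S \<in> cylinder Q P"
            using S(1) top[OF S] by (simp add: cylinder_def)
        qed (use \<open>\<tau> \<in> P\<close> U(2) in \<open>auto simp: W_def\<close>)
        moreover have "{S \<in> cylinder Q P. \<not> Inl ` \<tau> \<subseteq> S} = cylinder (Q - {\<tau>}) P"
        proof -
          have "S \<in> cylinder (Q - {\<tau>}) P \<longleftrightarrow> S \<in> cylinder Q P \<and> Inl -` S \<noteq> \<tau>" for S
            by (auto simp: cylinder_def)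
          moreover have "Inl ` \<tau> \<subseteq> S \<longleftrightarrow> Inl -` S = \<tau>" if "S \<in> cylinder Q P" for S
            using top[OF that] by auto
          ultimately show ?thesis unfolding set_eq_iff mem_Collect_eq by metis
        qed
        moreover have "ac (cylinder (Q - {\<tau>}) P) \<longleftrightarrow> ac (cylinder {{}} P)"
        proof -
          have down: "\<forall>\<rho>\<in>Q - {\<tau>}. \<forall>\<rho>'. \<rho>' \<subseteq> \<rho> \<longrightarrow> \<rho>' \<in> Q - {\<tau>}"
          proof (intro ballI allI impI)
            fix \<rho> \<rho>' assume \<rho>: "\<rho> \<in> Q - {\<tau>}" "\<rho>' \<subseteq> \<rho>"
            have "\<rho>' \<in> Q" using simplicial_complex_downward[OF Q' _ \<rho>(2)] \<rho>(1) by simp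
            moreover have "\<rho>' \<noteq> \<tau>" using \<tau>(2) \<rho> by auto
            ultimately show "\<rho>' \<in> Q - {\<tau>}" by simp
          qed
          have sub: "Q - {\<tau>} \<subset> Q" "Q - {\<tau>} \<subseteq> L" "{} \<in> Q - {\<tau>}"
            using Q(1,2) \<tau>(1) \<open>\<tau> \<noteq> {}\<close> by auto
          show ?thesis
            by (rule psubset.IH[OF sub(1), THEN mp, OF sub(2), THEN mp, OF sub(3), THEN mp, OF down])
        qed
        ultimately show ?thesis by (simp add: ac_def)
      qed simp
    qed
  qed
  have "cylinder L {} = (`) Inl ` L"
  proof (intro equalityI subsetI)
    fix S assume S: "S \<in> cylinder L {}"
    have "x \<in> Inl ` (Inl -` S)" if "x \<in> S" for x
      using S that by (cases x) (auto simp: cylinder_def order_complex_def)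
    then have "S = Inl ` (Inl -` S)" by auto
    moreover have "Inl -` S \<in> L" using S by (simp add: cylinder_def)
    ultimately show "S \<in> (`) Inl ` L" by (rule image_eqI)
  next
    fix S :: "('a + 'a set) set" assume "S \<in> (`) Inl ` L"
    then obtain T where T: "S = Inl ` T" "T \<in> L" by (elim imageE)
    have "Inl -` S = T" "Inr -` S = {}" using T(1) by auto
    then show "S \<in> cylinder L {}" using T by (auto simp: cylinder_def order_complex_def)
  qed
  then have "ac (cylinder L {}) \<longleftrightarrow> acyclic_at lt V L p"
    unfolding ac_def using L(1) W(1,2)
    by (simp add: acyclic_at_image[where lt = lt] sum_lt_def)
  moreover have "cylinder {{}} P = (`) Inr ` order_complex P"
  proof (intro equalityI subsetI)
    fix S assume S: "S \<in> cylinder {{}} P"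
    have "x \<in> Inr ` (Inr -` S)" if "x \<in> S" for x
      using S that by (cases x) (auto simp: cylinder_def order_complex_def)
    then have "S = Inr ` (Inr -` S)" by auto
    moreover have "Inr -` S \<in> order_complex P" using S by (simp add: cylinder_def)
    ultimately show "S \<in> (`) Inr ` order_complex P" by (rule image_eqI)
  next
    fix S :: "('a + 'a set) set" assume "S \<in> (`) Inr ` order_complex P"
    then obtain T where T: "S = Inr ` T" "T \<in> order_complex P" by (elim imageE)
    have "Inr -` S = T" "Inl -` S = {}" using T(1) by auto
    then show "S \<in> cylinder {{}} P" using T by (auto simp: cylinder_def)
  qed
  then have "ac (cylinder {{}} P) \<longleftrightarrow> acyclic_at lt' U (order_complex P) p"
    unfolding ac_def using simplicial_complex_order_complex[OF U] W(1,3)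
    by (simp add: acyclic_at_image[where lt = lt'] sum_lt_def)
  moreover have "ac (cylinder L P) \<longleftrightarrow> ac (cylinder L {})"
    using add U by (meson finite_subset order.refl)
  moreover have "ac (cylinder L P) \<longleftrightarrow> ac (cylinder {{}} P)"
    using remove[OF \<open>finite L\<close>] L by (auto simp: simplicial_complex_def)
  ultimately show ?thesis by simp
qed

section \<open>Matroid rank and flats\<close>

context
  fixes V :: "'v set" and M :: "'v set set"
  assumes M: "matroid V M"
begin

lemma indep_finite: "I \<in> M \<Longrightarrow> finite I"
  using M by (auto simp: matroid_def intro: finite_subset)

lemma indep_subset: "I \<in> M \<Longrightarrow> J \<subseteq> I \<Longrightarrow> J \<in> M"
  using M by (auto simp: matroid_def)

lemma finite_indep: "finite M"
  using M by (auto simp: matroid_def intro: finite_subset)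

lemma card_le_rank: "I \<in> M \<Longrightarrow> I \<subseteq> X \<Longrightarrow> card I \<le> mrank (induced M X)"
  unfolding mrank_def using finite_indep by (intro Max_ge) (auto simp: induced_def)

lemma rank_witness:
  obtains I where "I \<in> M" "I \<subseteq> X" "card I = mrank (induced M X)"
proof -
  have "{} \<in> induced M X" using M by (auto simp: matroid_def induced_def)
  then have "Max (card ` induced M X) \<in> card ` induced M X"
    using finite_indep by (intro Max_in) (auto simp: induced_def)
  then show thesis using that by (auto simp: mrank_def induced_def)
qed

lemma rank_mono: "X \<subseteq> Y \<Longrightarrow> mrank (induced M X) \<le> mrank (induced M Y)"
  by (metis card_le_rank order.trans rank_witness)

text \<open>A maximal independent set between \<open>I\<close> and \<open>X\<close> cannot be
  smaller than a rank witness for \<open>X\<close>, since the exchange axiom would enlarge it inside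
  \<open>X\<close>.\<close>

lemma extend_indep:
  assumes "I \<in> M" "I \<subseteq> X"
  obtains J where "J \<in> M" "I \<subseteq> J" "J \<subseteq> X" "card J = mrank (induced M X)"
proof -
  let ?ext = "\<lambda>J. J \<in> M \<and> I \<subseteq> J \<and> J \<subseteq> X"
  have "finite (Collect ?ext)" using finite_indep by simp
  moreover have "I \<in> Collect ?ext" using assms by simp
  ultimately obtain J where "J \<in> Collect ?ext" "\<forall>Y\<in>Collect ?ext. J \<subseteq> Y \<longrightarrow> J = Y"
    using finite_has_maximal2[of "Collect ?ext" I] by auto
  then have J: "?ext J" "\<And>Y. ?ext Y \<Longrightarrow> J \<subseteq> Y \<Longrightarrow> J = Y"
    by simp_all
  obtain B where B: "B \<in> M" "B \<subseteq> X" "card B = mrank (induced M X)"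
    by (rule rank_witness)
  have "\<not> card J < card B"
  proof
    assume "card J < card B"
    then obtain x where "x \<in> B - J" "insert x J \<in> M"
      using M J(1) B(1) unfolding matroid_def by meson
    then show False using J B(2) by blast
  qed
  moreover have "card J \<le> card B" using J(1) B(3) card_le_rank by simp
  ultimately show thesis using that[of J] J(1) B(3) by simp
qed

text \<open>Extend a largest independent subset \<open>I\<close> of \<open>A\<close> to a largest
  one \<open>J\<close> of \<open>F\<close>. Exchange against a larger independent subset of
  \<open>insert x F\<close> must add \<open>x\<close> itself, as any other element would give too
  large an independent set within \<open>F\<close>; hence \<open>insert x I\<close> is
  independent.\<close>

lemma rank_insert_mono:
  assumes "A \<subseteq> F" and "mrank (induced M F) < mrank (induced M (insert x F))"
  shows "mrank (induced M A) < mrank (induced M (insert x A))"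
proof -
  obtain I where I: "I \<in> M" "I \<subseteq> A" "card I = mrank (induced M A)" by (rule rank_witness)
  then obtain J where J: "J \<in> M" "I \<subseteq> J" "J \<subseteq> F" "card J = mrank (induced M F)"
    using assms(1) extend_indep[of I F] by blast
  obtain B where B: "B \<in> M" "B \<subseteq> insert x F" "card B = mrank (induced M (insert x F))"
    by (rule rank_witness)
  have "card J < card B" using J B assms(2) by simp
  then obtain y where y: "y \<in> B - J" "insert y J \<in> M"
    using M J(1) B(1) unfolding matroid_def by meson
  have "y = x"
  proof (rule ccontr)
    assume "y \<noteq> x"
    then have "card (insert y J) \<le> mrank (induced M F)"
      using y B J by (intro card_le_rank) auto
    then show False using y J indep_finite by simp
  qed
  then have "insert x I \<in> M" "x \<notin> I" using y J(2) indep_subset by blast+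
  then have "card (insert x I) \<le> mrank (induced M (insert x A))"
    using I(2) by (intro card_le_rank) auto
  then show ?thesis using I \<open>x \<notin> I\<close> indep_finite by simp
qed

text \<open>A point outside the intersection misses \<open>F\<close> or \<open>G\<close> and raises
  the rank there; by \<open>rank_insert_mono\<close> it does so already over the smaller
  set.\<close>

lemma flat_Int:
  assumes F: "flat V M F" and G: "flat V M G"
  shows "flat V M (F \<inter> G)"
  unfolding flat_def
proof (intro conjI ballI)
  show "F \<inter> G \<subseteq> V" using F by (auto simp: flat_def)
  fix x assume x: "x \<in> V - F \<inter> G"
  have "mrank (induced M (F \<inter> G)) < mrank (induced M (insert x (F \<inter> G)))"
  proof (cases "x \<in> F")
    case False
    then have "mrank (induced M F) < mrank (induced M (insert x F))"
      using F x by (simp add: flat_def)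
    then show ?thesis by (rule rank_insert_mono[OF Int_lower1])
  next
    case True
    then have "mrank (induced M G) < mrank (induced M (insert x G))"
      using G x by (simp add: flat_def)
    then show ?thesis by (rule rank_insert_mono[OF Int_lower2])
  qed
  then show "mrank (induced M (F \<inter> G)) < mrank (induced M (F \<inter> G \<union> {x}))" by simp
qed

lemma flat_rank_eq:
  assumes "flat V M F" "G \<subseteq> V" "F \<subseteq> G" "mrank (induced M G) \<le> mrank (induced M F)"
  shows "F = G"
proof (rule ccontr)
  assume "F \<noteq> G"
  then obtain x where x: "x \<in> G - F" using assms by blast
  then have "mrank (induced M F) < mrank (induced M (F \<union> {x}))"
    using assms unfolding flat_def by blast
  also have "\<dots> \<le> mrank (induced M G)" using x assms by (intro rank_mono) auto
  finally show False using assms by simp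
qed

text \<open>A superset of \<open>X\<close> of the same rank that is maximal under inclusion is a
  flat, because adding any further point must change its rank.\<close>

lemma closure_flat:
  assumes "X \<subseteq> V"
  obtains F where "flat V M F" "X \<subseteq> F" "mrank (induced M F) = mrank (induced M X)"
proof -
  let ?cl = "\<lambda>F. X \<subseteq> F \<and> F \<subseteq> V \<and> mrank (induced M F) = mrank (induced M X)"
  have "Collect ?cl \<subseteq> Pow V" by auto
  then have "finite (Collect ?cl)" using M by (auto simp: matroid_def intro: finite_subset)
  moreover have "X \<in> Collect ?cl" using assms by simp
  ultimately obtain F where "F \<in> Collect ?cl" "\<forall>Y\<in>Collect ?cl. F \<subseteq> Y \<longrightarrow> F = Y"
    using finite_has_maximal2[of "Collect ?cl" X] by auto
  then have F: "?cl F" "\<And>Y. ?cl Y \<Longrightarrow> F \<subseteq> Y \<Longrightarrow> F = Y"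
    by simp_all
  have "mrank (induced M F) < mrank (induced M (F \<union> {x}))" if "x \<in> V - F" for x
  proof -
    have "mrank (induced M F) \<noteq> mrank (induced M (F \<union> {x}))"
    proof
      assume "mrank (induced M F) = mrank (induced M (F \<union> {x}))"
      then have "F = F \<union> {x}" using F(1) that by (intro F(2)) auto
      then show False using that by blast
    qed
    then show ?thesis using rank_mono[OF Un_upper1, of F "{x}"] by simp
  qed
  then show thesis using that[of F] F(1) by (simp add: flat_def)
qed

text \<open>Since \<open>k\<close> is at most the rank of \<open>M\<close>, every independent set
  with fewer than \<open>k\<close> elements can be enlarged, so the bases of the truncation are
  exactly the independent sets of size \<open>k\<close>.\<close>

lemma contains_truncation_basis_iff:
  assumes "k \<le> mrank M"
  shows "(\<exists>B. is_basis (truncation M k) B \<and> B \<subseteq> \<sigma>) \<longleftrightarrow> k \<le> mrank (induced M \<sigma>)"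
proof -
  have "induced M V = M" using M by (auto simp: induced_def matroid_def)
  then obtain A where A: "A \<in> M" "k \<le> card A"
    using rank_witness[of V] assms by metis
  have basis: "is_basis (truncation M k) B \<longleftrightarrow> B \<in> M \<and> card B = k" for B
  proof
    assume B: "is_basis (truncation M k) B"
    then have "B \<in> M" "card B \<le> k" by (auto simp: is_basis_def truncation_def)
    moreover have "\<not> card B < k"
    proof
      assume "card B < k"
      then obtain x where x: "x \<in> A - B" "insert x B \<in> M"
        using M \<open>B \<in> M\<close> A unfolding matroid_def by (meson less_le_trans)
      then have "insert x B \<in> truncation M k"
        using \<open>card B < k\<close> indep_finite[OF \<open>B \<in> M\<close>] by (simp add: truncation_def)
      then have "insert x B = B" using B by (auto simp: is_basis_def)
      then show False using x by auto
    qed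
    ultimately show "B \<in> M \<and> card B = k" by simp
  next
    assume B: "B \<in> M \<and> card B = k"
    have "A = B" if "A \<in> truncation M k" "B \<subseteq> A" for A
      using card_seteq[OF indep_finite that(2)] that(1) B by (simp add: truncation_def)
    then show "is_basis (truncation M k) B"
      using B by (simp add: is_basis_def truncation_def)
  qed
  show ?thesis
  proof
    assume "\<exists>B. is_basis (truncation M k) B \<and> B \<subseteq> \<sigma>"
    then obtain B where "B \<in> M" "card B = k" "B \<subseteq> \<sigma>" using basis by auto
    then show "k \<le> mrank (induced M \<sigma>)" using card_le_rank[of B \<sigma>] by simp
  next
    assume k: "k \<le> mrank (induced M \<sigma>)"
    obtain I where I: "I \<in> M" "I \<subseteq> \<sigma>" "card I = mrank (induced M \<sigma>)" by (rule rank_witness)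
    then obtain B where B: "B \<subseteq> I" "card B = k"
      using k obtain_subset_with_card_n[of k I] by auto
    then have "is_basis (truncation M k) B" using basis indep_subset[OF I(1)] by simp
    then show "\<exists>B. is_basis (truncation M k) B \<and> B \<subseteq> \<sigma>" using B I(2) by blast
  qed
qed

end

section \<open>Intersections over families of flats\<close>

text \<open>The cylinder comparison applies to the complex induced outside \<open>F\<close>: a
  simplex not inside \<open>F\<close> has a vertex outside \<open>F\<close>, and its faces avoiding
  \<open>F\<close> form a cone with that vertex as apex.\<close>

lemma acyclic_at_order_complex_not_subset:
  assumes C: "simplicial_complex V C" and p: "enat p < eta_H (induced C (V - F))"
  shows "acyclic_at vorder_lt C (order_complex {\<sigma> \<in> C. \<not> \<sigma> \<subseteq> F}) p"
proof -
  let ?L = "insert {} (induced C (V - F))"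
  have "finite C" using C by (auto simp: simplicial_complex_def intro: finite_subset)
  have L: "simplicial_complex V (induced C (V - F))" "simplicial_complex V ?L"
    using C unfolding simplicial_complex_def induced_def by blast+
  have "enat (Suc p) \<le> eta_H (induced C (V - F))"
    using p by (simp add: Suc_ile_eq)
  then have "acyclic_at vorder_lt V ?L p"
    unfolding enat_le_eta_H_iff[OF L(1)] by blast
  moreover have "acyclic_at vorder_lt C (order_complex {\<sigma> \<in> C. \<not> \<sigma> \<subseteq> F}) p \<longleftrightarrow> acyclic_at vorder_lt V ?L p"
  proof (rule acyclic_at_order_complex_iff[OF tournament_vorder_lt tournament_vorder_lt L(2) _ \<open>finite C\<close>])
    fix \<sigma> assume "\<sigma> \<in> {\<sigma> \<in> C. \<not> \<sigma> \<subseteq> F}"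
    then obtain v where v: "\<sigma> \<in> C" "v \<in> \<sigma>" "v \<notin> F" by blast
    have \<sigma>: "\<sigma> \<subseteq> V" "\<And>\<tau>. \<tau> \<subseteq> \<sigma> \<Longrightarrow> \<tau> \<in> C" using C v(1) by (auto simp: simplicial_complex_def)
    have "insert v \<tau> \<in> ?L" if "\<tau> \<in> ?L" "\<tau> \<subseteq> \<sigma>" for \<tau>
    proof -
      have "insert v \<tau> \<subseteq> \<sigma>" using v that by simp
      then show ?thesis using \<sigma> v that by (auto simp: induced_def)
    qed
    then show "\<exists>v\<in>\<sigma> \<inter> V. \<forall>\<tau>\<in>?L. \<tau> \<subseteq> \<sigma> \<longrightarrow> insert v \<tau> \<in> ?L"
      using v \<sigma>(1) by blast
  qed (auto simp: induced_def)
  ultimately show ?thesis by simp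
qed

text \<open>The sum \<open>p + j\<close> is the budget: passing from an intersection of up-sets to
  their union turns \<open>p\<close> into \<open>Suc p\<close> and \<open>j\<close> into
  \<open>j - 1\<close>. The outer induction on \<open>j\<close> treats the union, for arbitrary
  families; the inner one adds flats one at a time.\<close>

lemma acyclic_at_order_complex_not_subset_family:
  assumes C: "simplicial_complex V C" and M: "matroid V M"
    and eta: "\<And>F. flat V M F \<Longrightarrow> mrank (induced M F) < k \<Longrightarrow>
      enat (k + m) \<le> eta_H (induced C (V - F)) + enat (mrank (induced M F))"
    and j: "j < k" "p + j < k + m"
    and \<F>: "finite \<F>" "\<F> \<noteq> {}" "\<And>F. F \<in> \<F> \<Longrightarrow> flat V M F \<and> mrank (induced M F) \<le> j"
  shows "acyclic_at vorder_lt C (order_complex {\<sigma> \<in> C. \<forall>F\<in>\<F>. \<not> \<sigma> \<subseteq> F}) p"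
  using j \<F>
proof (induction j arbitrary: p \<F> rule: less_induct)
  case (less j)
  have finC: "finite C" using C by (auto simp: simplicial_complex_def intro: finite_subset)
  have single: "acyclic_at vorder_lt C (order_complex {\<sigma> \<in> C. \<not> \<sigma> \<subseteq> F}) p"
    if "flat V M F" "mrank (induced M F) \<le> j" for F
  proof (rule acyclic_at_order_complex_not_subset[OF C])
    have "enat (k + m) \<le> eta_H (induced C (V - F)) + enat (mrank (induced M F))"
      using that less.prems(1) by (intro eta) simp_all
    \<comment> \<open>The rank of \<open>F\<close> is at most \<open>j\<close>, so adding it to
      \<open>p\<close> stays below \<open>k + m\<close>; cancelling it leaves the claim.\<close>
    then show "enat p < eta_H (induced C (V - F))"
      using that less.prems(2) by (cases "eta_H (induced C (V - F))") auto
  qed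
  show ?case
    using less.prems(3-5)
  proof (induction \<F> rule: finite_ne_induct)
    case (singleton F)
    then show ?case using single by simp
  next
    case (insert G \<F>)
    let ?A = "{\<sigma> \<in> C. \<forall>F\<in>\<F>. \<not> \<sigma> \<subseteq> F}"
    let ?B = "{\<sigma> \<in> C. \<not> \<sigma> \<subseteq> G}"
    let ?G = "(\<lambda>F. F \<inter> G) ` \<F>"
    \<comment> \<open>If the rank did not drop, the flat \<open>F \<inter> G\<close> would equal
      both \<open>F\<close> and \<open>G\<close>, although \<open>G\<close> is new to the
      family.\<close>
    have lower: "flat V M (F \<inter> G) \<and> mrank (induced M (F \<inter> G)) < j" if "F \<in> \<F>" for F
    proof -
      have F: "flat V M F" "mrank (induced M F) \<le> j" and G: "flat V M G" "mrank (induced M G) \<le> j"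
        using insert.prems that by auto
      have FG: "flat V M (F \<inter> G)" using M F(1) G(1) by (rule flat_Int)
      have "mrank (induced M (F \<inter> G)) < j"
      proof (rule ccontr)
        assume "\<not> mrank (induced M (F \<inter> G)) < j"
        then have "F \<inter> G = F" "F \<inter> G = G"
          using flat_rank_eq[OF M FG] F G by (auto simp: flat_def)
        then have "F = G" by simp
        then show False using that insert.hyps by simp
      qed
      then show ?thesis using FG by simp
    qed
    have AB: "?A \<union> ?B = {\<sigma> \<in> C. \<forall>H\<in>?G. \<not> \<sigma> \<subseteq> H}" by auto
    \<comment> \<open>Some rank lies strictly below \<open>j\<close>, so \<open>j - 1\<close> is a
      true predecessor and the budget is preserved.\<close>
    have "0 < j" using lower insert.hyps(2) by (metis all_not_in_conv gr_zeroI not_less_zero)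
    have "acyclic_at vorder_lt C (order_complex (?A \<union> ?B)) (Suc p)"
      unfolding AB
    proof (rule less.IH[of "j - 1"])
      show "j - 1 < j" "j - 1 < k" "Suc p + (j - 1) < k + m"
        using \<open>0 < j\<close> less.prems(1,2) by simp_all
      show "finite ?G" "?G \<noteq> {}" using insert.hyps by simp_all
      fix H assume "H \<in> ?G"
      then obtain F where "F \<in> \<F>" "H = F \<inter> G" by blast
      then show "flat V M H \<and> mrank (induced M H) \<le> j - 1" using lower[of F] by auto
    qed
    moreover have "order_complex (?A \<union> ?B) = order_complex ?A \<union> order_complex ?B"
      using finC by (intro order_complex_Un) auto
    moreover have "acyclic_at vorder_lt C (order_complex ?A) p"
      using insert.IH insert.prems by simp
    moreover have "acyclic_at vorder_lt C (order_complex ?B) p"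
      using single insert.prems by simp
    moreover have "simplicial_complex C (order_complex ?A)" "simplicial_complex C (order_complex ?B)"
      using finC by (auto intro: simplicial_complex_order_complex)
    ultimately have "acyclic_at vorder_lt C (order_complex ?A \<inter> order_complex ?B) p"
      by (intro acyclic_at_Int[OF tournament_vorder_lt]) simp_all
    moreover have "?A \<inter> ?B = {\<sigma> \<in> C. \<forall>F\<in>insert G \<F>. \<not> \<sigma> \<subseteq> F}" by auto
    ultimately show ?case by (simp only: flip: order_complex_Int)
  qed
qed

section \<open>From flats of bounded rank to the intersection complex\<close>

theorem theorem5p6:
  fixes V :: "'v set" and C M :: "'v set set" and k m :: nat
  assumes "simplicial_complex V C"
    and "matroid V M"
    and "1 \<le> k" and "k \<le> mrank M"
    and "\<forall>X. X \<subseteq> V \<and> flat V M (V - X) \<and> mrank (induced M (V - X)) \<le> k - 1 \<longrightarrow>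
           eta_H (induced C X) + enat (mrank (induced M (V - X))) \<ge> enat (k + m)"
  shows "eta_H (Int_cx C (truncation M k)) \<ge> enat (m + 1)"
proof -
  note C = assms(1) and M = assms(2)
  have fin: "finite V" "finite C" using C by (auto simp: simplicial_complex_def intro: finite_subset)
  define \<F> where "\<F> = {F. flat V M F \<and> mrank (induced M F) \<le> k - 1}"
  have "\<F> \<subseteq> Pow V" by (auto simp: \<F>_def flat_def)
  then have "finite \<F>" using fin(1) by (auto intro: finite_subset)
  \<comment> \<open>The closure of the empty set has rank 0; nonemptiness starts the induction over
    the family.\<close>
  have "\<F> \<noteq> {}"
  proof -
    have "mrank (induced M {}) = 0"
      using rank_witness[OF M, of "{}"] by (metis card.empty subset_empty)
    moreover obtain F where "flat V M F" "mrank (induced M F) = mrank (induced M {})"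
      using closure_flat[OF M empty_subsetI] by metis
    ultimately have "F \<in> \<F>" by (simp add: \<F>_def)
    then show ?thesis by blast
  qed
  have eta: "enat (k + m) \<le> eta_H (induced C (V - F)) + enat (mrank (induced M F))"
    if "flat V M F" "mrank (induced M F) < k" for F
  proof -
    have "V - (V - F) = F" using that(1) by (auto simp: flat_def)
    then show ?thesis using assms(5)[rule_format, of "V - F"] that by auto
  qed
  have "(\<exists>B. is_basis (truncation M k) B \<and> B \<subseteq> \<sigma>) \<longleftrightarrow> (\<forall>F\<in>\<F>. \<not> \<sigma> \<subseteq> F)" if "\<sigma> \<in> C" for \<sigma>
  proof -
    have "\<sigma> \<subseteq> V" using C that by (auto simp: simplicial_complex_def)
    \<comment> \<open>A simplex of rank below \<open>k\<close> lies in its closure, a flat of the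
      same rank and hence a member of \<open>\<F>\<close>; the converse is monotonicity of
      rank.\<close>
    have "k \<le> mrank (induced M \<sigma>) \<longleftrightarrow> (\<forall>F\<in>\<F>. \<not> \<sigma> \<subseteq> F)"
    proof
      assume "k \<le> mrank (induced M \<sigma>)"
      then have "\<not> \<sigma> \<subseteq> F" if "mrank (induced M F) \<le> k - 1" for F
        using rank_mono[OF M, of \<sigma> F] assms(3) that by auto
      then show "\<forall>F\<in>\<F>. \<not> \<sigma> \<subseteq> F" by (simp add: \<F>_def)
    next
      assume *: "\<forall>F\<in>\<F>. \<not> \<sigma> \<subseteq> F"
      obtain F where F: "flat V M F" "\<sigma> \<subseteq> F" "mrank (induced M F) = mrank (induced M \<sigma>)"
        by (rule closure_flat[OF M \<open>\<sigma> \<subseteq> V\<close>])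
      then have "F \<notin> \<F>" using * by blast
      then show "k \<le> mrank (induced M \<sigma>)" using F by (simp add: \<F>_def)
    qed
    then show ?thesis using contains_truncation_basis_iff[OF M assms(4)] by simp
  qed
  then have "{\<sigma> \<in> C. \<exists>B. is_basis (truncation M k) B \<and> B \<subseteq> \<sigma>} = {\<sigma> \<in> C. \<forall>F\<in>\<F>. \<not> \<sigma> \<subseteq> F}"
    by auto
  then have Int: "Int_cx C (truncation M k) = order_complex {\<sigma> \<in> C. \<forall>F\<in>\<F>. \<not> \<sigma> \<subseteq> F}" (is "_ = order_complex ?P")
    by (simp add: Int_cx_def order_complex_def)
  have cx: "simplicial_complex C (order_complex ?P)"
    using fin(2) by (auto intro: simplicial_complex_order_complex)
  \<comment> \<open>With \<open>j = k - 1\<close> and \<open>1 \<le> k\<close>, the budget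
    \<open>p + j < k + m\<close> reads \<open>p \<le> m\<close>.\<close>
  have "acyclic_at vorder_lt C (order_complex ?P) p" if "p < m + 1" for p
    by (rule acyclic_at_order_complex_not_subset_family[OF C M eta, where j = "k - 1"])
      (use that assms(3) \<open>finite \<F>\<close> \<open>\<F> \<noteq> {}\<close> in \<open>auto simp: \<F>_def\<close>)
  \<comment> \<open>The empty chain already belongs to an order complex.\<close>
  moreover have "insert {} (order_complex ?P) = order_complex ?P" by (auto simp: order_complex_def)
  ultimately show ?thesis
    unfolding Int enat_le_eta_H_iff[OF cx] by simp
qed

end
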